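(* Let $d\ge 2$ and $D\ge 1$ be integers, let $\alpha_j^{(i)}\ge 0$ ($i=1,\dots,d$, $j=1,\dots,D$) be constants, and let $C>0$ be a constant with $C\ge \max_{1\le i\le d}\sum_{j=1}^D\alpha_j^{(i)}$. Let $Y_1,\dots,Y_d,Z_1,\dots,Z_D$ be independent unit Fréchet random variables, and let ${\bf X}=(X_1,\dots,X_d)$ be defined by $$X_i=\max\left\{\max_{1\le j\le D}\alpha_j^{(i)}Z_j,\ \Big(C-\sum_{j=1}^{D}\alpha_j^{(i)}\Big)Y_i\right\},\qquad i=1,\dots,d.$$ Then ${\bf X}$ has a multivariate extreme value distribution, its distribution function is given, for all $x_1,\dots,x_d>0$, by $$F_{\bf X}(x_1,\dots,x_d)=\prod_{j=1}^{D}\left(\min_{1\le i\le d}e^{-x_i^{-1}\alpha_j^{(i)}}\right)\prod_{i=1}^{d}e^{-x_i^{-1}\left(C-\sum_{j=1}^{D}\alpha_j^{(i)}\right)},$$ and its copula is given, for all $(u_1,\dots,u_d)\in[0,1]^d$ (with $0^0=1$), by $$C_{\bf X}(u_1,\dots,u_d)=\prod_{j=1}^{D}\left(\min_{1\le i\le d}u_i^{\alpha_j^{(i)}/C}\right)\prod_{i=1}^{d}u_i^{\,1-\frac1C\sum_{j=1}^{D}\alpha_j^{(i)}}.$$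
   Context: A unit Fréchet random variable $Z$ has distribution function $P(Z\le x)=e^{-1/x}$ for $x>0$ and $0$ for $x\le 0$. The copula of ${\bf X}$ is $C_{\bf X}(u_1,\dots,u_d)=F_{\bf X}(F_{X_1}^{-1}(u_1),\dots,F_{X_d}^{-1}(u_d))$ for $(u_1,\dots,u_d)\in(0,1)^d$, extended by continuity to $[0,1]^d$, where $F_{\bf X}$ is the joint distribution function, $F_{X_i}$ is the distribution function of $X_i$ and $F_{X_i}^{-1}(u)=\inf\{x: F_{X_i}(x)\ge u\}$ is its generalised inverse. A random vector has a multivariate extreme value distribution if its univariate margins are (non-degenerate) univariate extreme value distributions (Fréchet, Gumbel or Weibull type, up to location and scale) and its copula $C_{\bf X}$ is max-stable: $C_{\bf X}(u_1,\dots,u_d)^t=C_{\bf X}(u_1^t,\dots,u_d^t)$ for all $t>0$ and $(u_1,\dots,u_d)\in[0,1]^d$. *)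

theory Defs
  imports "HOL-Probability.Probability"
begin

definition unit_frechet :: "'a measure \<Rightarrow> ('a \<Rightarrow> real) \<Rightarrow> bool" where
  "unit_frechet M Z \<longleftrightarrow>
     Z \<in> borel_measurable M \<and>
     (\<forall>x. cdf (distr M borel Z) x = (if x > 0 then exp (- 1 / x) else 0))"

(* The library function cdf only covers measures on the real line. The order on
   real ^ 'n is componentwise, so {..x} is the orthant of points below x. *)
definition joint_cdf :: "(real ^ 'n) measure \<Rightarrow> real ^ 'n \<Rightarrow> real" where
  "joint_cdf N x = measure N {..x}"

definition margin :: "(real ^ 'n) measure \<Rightarrow> 'n \<Rightarrow> real measure" where
  "margin N i = distr N borel (\<lambda>x. x $ i)"

definition gen_inverse :: "(real \<Rightarrow> real) \<Rightarrow> real \<Rightarrow> real" where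
  "gen_inverse F u = Inf {x. F x \<ge> u}"

definition copula_interior :: "(real ^ 'n) measure \<Rightarrow> real ^ 'n \<Rightarrow> real" where
  "copula_interior N u = joint_cdf N (\<chi> i. gen_inverse (cdf (margin N i)) (u $ i))"

(* box 0 1 is the open unit cube. On the remaining points of the closed cube the
   copula is the limit from inside; the value is meaningful only where that
   limit exists, which is the case when all margins are continuous. *)
definition copula :: "(real ^ 'n) measure \<Rightarrow> real ^ 'n \<Rightarrow> real" where
  "copula N u =
     (if u \<in> box 0 1 then copula_interior N u
      else Lim (at u within box 0 1) (copula_interior N))"

definition frechet_cdf :: "real \<Rightarrow> real \<Rightarrow> real" where
  "frechet_cdf a x = (if x > 0 then exp (- (x powr (- a))) else 0)"

definition gumbel_cdf :: "real \<Rightarrow> real" where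
  "gumbel_cdf x = exp (- exp (- x))"

definition weibull_cdf :: "real \<Rightarrow> real \<Rightarrow> real" where
  "weibull_cdf a x = (if x < 0 then exp (- ((- x) powr a)) else 1)"

definition extreme_value_cdf :: "(real \<Rightarrow> real) \<Rightarrow> bool" where
  "extreme_value_cdf F \<longleftrightarrow>
     (\<exists>G \<mu> \<sigma>. \<sigma> > 0 \<and>
        (G = gumbel_cdf \<or> (\<exists>a>0. G = frechet_cdf a) \<or> (\<exists>a>0. G = weibull_cdf a)) \<and>
        (\<forall>x. F x = G ((x - \<mu>) / \<sigma>)))"

(* Since t > 0, powr has the right value 0 at base 0 here. *)
definition max_stable :: "(real ^ 'n \<Rightarrow> real) \<Rightarrow> bool" where
  "max_stable K \<longleftrightarrow>
     (\<forall>t>0. \<forall>u\<in>cbox 0 1. K u powr t = K (\<chi> i. (u $ i) powr t))"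

definition multivariate_extreme_value :: "(real ^ 'n) measure \<Rightarrow> bool" where
  "multivariate_extreme_value N \<longleftrightarrow>
     prob_space N \<and> sets N = sets borel \<and>
     (\<forall>i. extreme_value_cdf (cdf (margin N i))) \<and>
     max_stable (copula N)"

(* Real power with 0^0 = 1, whereas 0 powr 0 = 0 in the library. *)
definition rpow :: "real \<Rightarrow> real \<Rightarrow> real" where
  "rpow x a = (if a = 0 then 1 else x powr a)"

end

theory Submission
  imports Defs "HOL-Real_Asymp.Real_Asymp"
begin

text \<open>
  For \<open>x > 0\<close> the event \<open>X \<le> x\<close> is an intersection of events \<open>c k * W k \<le> 1\<close>, where \<open>c k \<ge> 0\<close>
  and \<open>W\<close> runs over the independent variables \<open>Y i\<close>, \<open>Z j\<close>; the coefficient of \<open>Z j\<close> is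
  \<open>MAX i. \<alpha> i j / x $ i\<close>. Such an intersection has probability \<open>exp (- (\<Sum>k. c k))\<close>, which gives both the
  joint distribution function and the margins, all with distribution function \<open>exp (- C / x)\<close>.
  Substituting the quantiles \<open>- C / ln u\<close> yields the copula inside the unit cube. The resulting
  expression is continuous on the closed cube and homogeneous under powers.
\<close>

section \<open>Minima of exponentials and powers\<close>

lemma Min_exp_uminus:
  fixes f :: "'n::finite \<Rightarrow> real"
  shows "(MIN i. exp (- f i)) = exp (- (MAX i. f i))"
proof (rule Min_eqI)
  have "(MAX i. f i) \<in> range f"
    by (rule Max_in) auto
  then obtain i where i: "(MAX i. f i) = f i"
    by blast
  show "exp (- (MAX i. f i)) \<in> range (\<lambda>i. exp (- f i))"
    unfolding i by (rule rangeI)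
qed auto

lemma Min_powr:
  fixes f :: "'n::finite \<Rightarrow> real"
  assumes "\<And>i. f i \<ge> 0" and "t \<ge> 0"
  shows "(MIN i. f i) powr t = (MIN i. f i powr t)"
proof (rule Min_eqI [symmetric])
  have "(MIN i. f i) \<in> range f"
    by (rule Min_in) auto
  then obtain i where i: "(MIN i. f i) = f i"
    by blast
  show "(MIN i. f i) powr t \<in> range (\<lambda>i. f i powr t)"
    unfolding i by (rule rangeI)
  have "0 \<le> (MIN i. f i)"
    unfolding i by (rule assms)
  then show "(MIN i. f i) powr t \<le> y" if "y \<in> range (\<lambda>i. f i powr t)" for y
    using that assms by (auto intro!: powr_mono2)
qed auto

lemma continuous_on_Min_image:
  fixes f :: "'i \<Rightarrow> 'a::topological_space \<Rightarrow> real"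
  assumes "finite A" and "A \<noteq> {}" and "\<And>i. i \<in> A \<Longrightarrow> continuous_on S (f i)"
  shows "continuous_on S (\<lambda>x. MIN i\<in>A. f i x)"
  using assms by (induction rule: finite_ne_induct) (auto intro!: continuous_on_min)

section \<open>Real powers with value 1 at exponent 0\<close>

lemma rpow_nonneg: "x \<ge> 0 \<Longrightarrow> rpow x a \<ge> 0"
  by (simp add: rpow_def)

lemma rpow_eq_exp: "x > 0 \<Longrightarrow> rpow x a = exp (a * ln x)"
  by (simp add: rpow_def powr_def)

lemma rpow_powr: "rpow (x powr t) a = rpow x a powr t"
  by (simp add: rpow_def powr_powr mult.commute)

text \<open>For \<open>a = 0\<close> the function is constantly 1, even where \<open>f\<close>
  vanishes; for \<open>a > 0\<close> the power is continuous at base 0 too.\<close>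

lemma continuous_on_rpow:
  assumes "a \<ge> 0" and "continuous_on S f" and "\<And>x. x \<in> S \<Longrightarrow> f x \<ge> 0"
  shows "continuous_on S (\<lambda>x. rpow (f x) a)"
  using assms by (cases "a = 0") (auto simp: rpow_def intro!: continuous_on_powr')

text \<open>The shape of the claimed copula: each \<open>j\<close> gives a factor coupling all
  coordinates, caused by the shared \<open>Z j\<close>; the last product is the independent part,
  caused by the \<open>Y i\<close>.\<close>

definition power_mixture :: "('n::finite \<Rightarrow> 'm::finite \<Rightarrow> real) \<Rightarrow> ('n \<Rightarrow> real) \<Rightarrow> real ^ 'n \<Rightarrow> real" where
  "power_mixture a b u = (\<Prod>j\<in>UNIV. MIN i. rpow (u $ i) (a i j)) * (\<Prod>i\<in>UNIV. rpow (u $ i) (b i))"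

text \<open>Positive powers commute with products and minima of nonnegative numbers. This will be
  the max-stability of the copula.\<close>

lemma power_mixture_powr:
  assumes "t > 0" and u: "u \<in> cbox 0 1"
  shows "power_mixture a b u powr t = power_mixture a b (\<chi> i. (u $ i) powr t)"
proof -
  have nonneg: "u $ i \<ge> 0" for i
    using u by (auto simp: mem_box_cart)
  have "(MIN i. rpow (u $ i) (a i j)) powr t = (MIN i. rpow (u $ i powr t) (a i j))" for j
    using assms nonneg by (simp add: Min_powr rpow_nonneg rpow_powr)
  moreover have "(MIN i. rpow (u $ i) (a i j)) \<ge> 0" for j
    using nonneg by (simp add: rpow_nonneg)
  ultimately show ?thesis
    using nonneg
    by (simp add: power_mixture_def powr_mult prod_nonneg rpow_nonneg rpow_powr prod_powr_distrib)
qed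

lemma continuous_on_power_mixture:
  assumes "\<And>i j. a i j \<ge> 0" and "\<And>i. b i \<ge> 0"
  shows "continuous_on (cbox 0 1) (power_mixture a b)"
  unfolding power_mixture_def using assms
  by (intro continuous_intros continuous_on_Min_image continuous_on_rpow)
    (auto simp: mem_box_cart)

section \<open>Extension of a copula to the closed cube\<close>

lemma copula_eqI:
  fixes K :: "real ^ 'n \<Rightarrow> real"
  assumes cont: "continuous_on (cbox 0 1) K"
    and interior: "\<And>u. u \<in> box 0 1 \<Longrightarrow> copula_interior N u = K u"
    and u: "u \<in> cbox 0 1"
  shows "copula N u = K u"
proof (cases "u \<in> box 0 1")
  case True
  then show ?thesis
    by (simp add: copula_def interior)
next
  case False
  \<comment> \<open>The closure of the nonempty open cube is the closed cube, so the boundary point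
    \<open>u\<close> is a limit point and the limit defining \<open>copula\<close> is
    unique.\<close>
  have "box 0 (1 :: real ^ 'n) \<noteq> {}"
    by (simp add: interval_ne_empty_cart)
  then have "u \<in> closure (box 0 1 - {u})"
    using False u by simp
  then have nontrivial: "at u within box 0 1 \<noteq> bot"
    using not_trivial_limit_within [of u "box 0 1"] by blast
  have "(K \<longlongrightarrow> K u) (at u within box 0 1)"
    using cont u box_subset_cbox unfolding continuous_on_def by (blast intro: tendsto_within_subset)
  then have "(copula_interior N \<longlongrightarrow> K u) (at u within box 0 1)"
    by (rule Lim_transform_eventually) (auto simp: eventually_at_filter interior)
  then show ?thesis
    using False nontrivial by (simp add: copula_def tendsto_Lim)
qed

section \<open>Frechet margins and their quantiles\<close>

lemma extreme_value_cdf_frechet: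
  assumes "C > 0" and "\<And>x. F x = (if x > 0 then exp (- C / x) else 0)"
  shows "extreme_value_cdf F"
  unfolding extreme_value_cdf_def
proof (intro exI conjI allI)
  have "\<exists>a>0. frechet_cdf 1 = frechet_cdf a"
    using zero_less_one by blast
  then show "frechet_cdf 1 = gumbel_cdf \<or> (\<exists>a>0. frechet_cdf 1 = frechet_cdf a) \<or>
      (\<exists>a>0. frechet_cdf 1 = weibull_cdf a)"
    by blast
  show "F x = frechet_cdf 1 ((x - 0) / C)" for x
    using assms by (auto simp: frechet_cdf_def powr_minus zero_less_divide_iff field_simps)
qed (fact assms(1))

text \<open>As \<open>u > 0\<close>, no \<open>x \<le> 0\<close> reaches level \<open>u\<close>;
  solving for positive \<open>x\<close> shows that the superlevel set is a closed half-line, whose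
  infimum is its endpoint.\<close>

lemma gen_inverse_frechet:
  assumes "C > 0" and "0 < u" and "u < 1"
  shows "gen_inverse (\<lambda>x. if x > 0 then exp (- C / x) else 0) u = - C / ln u"
proof -
  have neg: "ln u < 0"
    using assms by simp
  have "u \<le> exp (- C / x) \<longleftrightarrow> - C / ln u \<le> x" if "x > 0" for x
  proof -
    have "u \<le> exp (- C / x) \<longleftrightarrow> ln u \<le> - C / x"
      using assms by (simp add: ln_ge_iff ln_le_cancel_iff flip: ln_le_cancel_iff [of u "exp _"])
    also have "\<dots> \<longleftrightarrow> - C / ln u \<le> x"
      using neg that by (simp add: field_simps)
    finally show ?thesis .
  qed
  moreover have "- C / ln u > 0"
    using neg assms by (intro divide_neg_neg) auto
  ultimately have "{x. (if x > 0 then exp (- C / x) else 0) \<ge> u} = {- C / ln u..}"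
    using assms by (auto split: if_splits)
  then show ?thesis
    by (simp add: gen_inverse_def)
qed

section \<open>Scaled bounds on independent unit Frechet variables\<close>

lemma unit_frechet_scaled:
  assumes "unit_frechet M Z" and "prob_space M" and "c \<ge> 0"
  shows "measure M {\<omega> \<in> space M. c * Z \<omega> \<le> 1} = exp (- c)"
proof (cases "c = 0")
  case True
  then show ?thesis
    using assms(2) by (simp add: prob_space.prob_space)
next
  case False
  with assms have c: "c > 0"
    by simp
  have [measurable]: "Z \<in> borel_measurable M"
    using assms by (simp add: unit_frechet_def)
  have "{\<omega> \<in> space M. c * Z \<omega> \<le> 1} = Z -` {..1 / c} \<inter> space M"
    using c by (auto simp: field_simps)
  then have "measure M {\<omega> \<in> space M. c * Z \<omega> \<le> 1} = cdf (distr M borel Z) (1 / c)"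
    by (simp add: cdf_def measure_distr)
  then show ?thesis
    using assms(1) c by (simp add: unit_frechet_def)
qed

lemma (in prob_space) prob_indep_unit_frechet:
  fixes W :: "'k::finite \<Rightarrow> 'a \<Rightarrow> real"
  assumes "indep_vars (\<lambda>_. borel) W UNIV" and "\<And>k. unit_frechet M (W k)" and "\<And>k. c k \<ge> 0"
  shows "prob {\<omega> \<in> space M. \<forall>k. c k * W k \<omega> \<le> 1} = exp (- (\<Sum>k\<in>UNIV. c k))"
proof -
  have "{\<omega> \<in> space M. \<forall>k. c k * W k \<omega> \<le> 1} = (\<Inter>k. W k -` {y. c k * y \<le> 1} \<inter> space M)"
    by auto
  also have "prob \<dots> = (\<Prod>k\<in>UNIV. prob (W k -` {y. c k * y \<le> 1} \<inter> space M))"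
    by (rule indep_varsD [OF assms(1)]) auto
  also have "\<dots> = (\<Prod>k\<in>UNIV. exp (- c k))"
    using unit_frechet_scaled [OF assms(2) prob_space_axioms assms(3)]
    by (intro prod.cong refl) (simp add: vimage_def Int_def conj_commute)
  also have "\<dots> = exp (- (\<Sum>k\<in>UNIV. c k))"
    by (simp add: sum_negf flip: exp_sum)
  finally show ?thesis .
qed

lemma sum_UNIV_Plus:
  "(\<Sum>k\<in>UNIV. f k) = (\<Sum>i\<in>UNIV. f (Inl i)) + (\<Sum>j\<in>UNIV. f (Inr j))"
  for f :: "'a::finite + 'b::finite \<Rightarrow> real"
  by (simp add: sum.Plus flip: UNIV_Plus_UNIV)

text \<open>Merges the bounds that all components impose on one shared \<open>Z j\<close> into a
  single bound. For negative \<open>z\<close> the largest coefficient no longer gives the largest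
  product, but then every product is nonpositive and the bound is automatic.\<close>

lemma Max_mult_le_one:
  fixes f :: "'n::finite \<Rightarrow> real"
  assumes "\<And>i. f i \<ge> 0"
  shows "(MAX i. f i) * z \<le> 1 \<longleftrightarrow> (\<forall>i. f i * z \<le> 1)"
proof
  assume le: "(MAX i. f i) * z \<le> 1"
  show "\<forall>i. f i * z \<le> 1"
  proof
    fix i
    show "f i * z \<le> 1"
    proof (cases "z \<ge> 0")
      case True
      have "f i * z \<le> (MAX i. f i) * z"
        using True by (intro mult_right_mono Max_ge) auto
      with le show ?thesis
        by linarith
    next
      case False
      then have "f i * z \<le> 0"
        using assms by (intro mult_nonneg_nonpos) auto
      then show ?thesis
        by linarith
    qed
  qed
next
  assume "\<forall>i. f i * z \<le> 1"
  moreover have "(MAX i. f i) \<in> range f"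
    by (rule Max_in) auto
  ultimately show "(MAX i. f i) * z \<le> 1"
    by fastforce
qed

section \<open>Distribution functions of random vectors\<close>

lemma borel_measurable_vecI:
  fixes X :: "'a \<Rightarrow> real ^ 'n"
  assumes "\<And>i. (\<lambda>\<omega>. X \<omega> $ i) \<in> borel_measurable M"
  shows "X \<in> borel_measurable M"
  using assms
  by (auto simp: borel_measurable_euclidean_space [where f = X] Basis_vec_def inner_axis)

lemma borel_measurable_vec_nth [measurable]: "(\<lambda>x :: real ^ 'n. x $ i) \<in> borel_measurable borel"
  by (intro borel_measurable_continuous_onI continuous_intros)

lemma joint_cdf_distr:
  assumes "X \<in> borel_measurable M"
  shows "joint_cdf (distr M borel X) x = measure M {\<omega> \<in> space M. \<forall>i. X \<omega> $ i \<le> x $ i}"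
proof -
  have "X -` {..x} \<inter> space M = {\<omega> \<in> space M. \<forall>i. X \<omega> $ i \<le> x $ i}"
    by (auto simp: less_eq_vec_def)
  moreover have "{..x} = (\<Inter>i. {y. y $ i \<le> x $ i})"
    by (auto simp: less_eq_vec_def)
  then have "{..x} \<in> sets borel"
    by simp
  ultimately show ?thesis
    using assms by (simp add: joint_cdf_def measure_distr)
qed

lemma cdf_margin_distr:
  assumes [measurable]: "X \<in> borel_measurable M"
  shows "cdf (margin (distr M borel X) i) x = measure M {\<omega> \<in> space M. X \<omega> $ i \<le> x}"
proof -
  have "margin (distr M borel X) i = distr M borel (\<lambda>\<omega>. X \<omega> $ i)"
    by (simp add: margin_def distr_distr o_def)
  moreover have "(\<lambda>\<omega>. X \<omega> $ i) -` {..x} \<inter> space M = {\<omega> \<in> space M. X \<omega> $ i \<le> x}"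
    by auto
  ultimately show ?thesis
    by (simp add: cdf_def measure_distr)
qed

theorem proposition2p1:
  fixes M :: "'a measure"
    and \<alpha> :: "'n::finite \<Rightarrow> 'm::finite \<Rightarrow> real"
    and C :: real
    and Y :: "'n \<Rightarrow> 'a \<Rightarrow> real"
    and Z :: "'m \<Rightarrow> 'a \<Rightarrow> real"
    and X :: "'a \<Rightarrow> real ^ 'n"
  assumes "prob_space M"
    and "CARD('n) \<ge> 2"
    and "\<And>i j. \<alpha> i j \<ge> 0"
    and "C > 0"
    and "C \<ge> (MAX i. \<Sum>j\<in>UNIV. \<alpha> i j)"
    and "\<And>i. unit_frechet M (Y i)"
    and "\<And>j. unit_frechet M (Z j)"
    and "prob_space.indep_vars M (\<lambda>_. borel) (case_sum Y Z) UNIV"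
    and "\<And>\<omega> i. \<omega> \<in> space M \<Longrightarrow>
           X \<omega> $ i = max (MAX j. \<alpha> i j * Z j \<omega>) ((C - (\<Sum>j\<in>UNIV. \<alpha> i j)) * Y i \<omega>)"
  shows "multivariate_extreme_value (distr M borel X) \<and>
    (\<forall>x. (\<forall>i. x $ i > 0) \<longrightarrow>
       joint_cdf (distr M borel X) x =
         (\<Prod>j\<in>UNIV. MIN i. exp (- (inverse (x $ i) * \<alpha> i j))) *
         (\<Prod>i\<in>UNIV. exp (- (inverse (x $ i) * (C - (\<Sum>j\<in>UNIV. \<alpha> i j)))))) \<and>
    (\<forall>u\<in>cbox 0 1.
       copula (distr M borel X) u =
         (\<Prod>j\<in>UNIV. MIN i. rpow (u $ i) (\<alpha> i j / C)) *
         (\<Prod>i\<in>UNIV. rpow (u $ i) (1 - (1 / C) * (\<Sum>j\<in>UNIV. \<alpha> i j))))"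
proof -
  interpret prob_space M
    by fact
  define N where "N = distr M borel X"
  define s where "s i = (\<Sum>j\<in>UNIV. \<alpha> i j)" for i
  define W where "W = case_sum Y Z"
  \<comment> \<open>This keeps the coefficients of the \<open>Y i\<close>, and later the exponents
    of the copula, nonnegative.\<close>
  have s_le: "s i \<le> C" for i
  proof -
    have "s i \<le> (MAX i. s i)"
      by (rule Max_ge) auto
    with assms(5) show ?thesis
      by (simp add: s_def)
  qed
  have W_indep: "indep_vars (\<lambda>_. borel) W UNIV"
    using assms(8) by (simp add: W_def)
  have W_frechet: "unit_frechet M (W k)" for k
    using assms(6,7) by (simp add: W_def split: sum.split)
  have X_le: "X \<omega> $ i \<le> x \<longleftrightarrow> (\<forall>j. \<alpha> i j * Z j \<omega> \<le> x) \<and> (C - s i) * Y i \<omega> \<le> x"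
    if "\<omega> \<in> space M" for \<omega> i x
    using that by (simp add: assms(9) s_def)
  have [measurable]: "Y i \<in> borel_measurable M" "Z j \<in> borel_measurable M" for i j
    using assms(6,7) by (auto simp: unit_frechet_def)
  have X_measurable [measurable]: "X \<in> borel_measurable M"
  proof (rule borel_measurable_vecI)
    fix i
    have "(\<lambda>\<omega>. max (MAX j. \<alpha> i j * Z j \<omega>) ((C - s i) * Y i \<omega>)) \<in> borel_measurable M"
      by measurable
    then show "(\<lambda>\<omega>. X \<omega> $ i) \<in> borel_measurable M"
      by (subst measurable_cong [OF assms(9)]) (simp_all add: s_def)
  qed

  \<comment> \<open>Joint distribution function\<close>
  have joint: "joint_cdf N x =
      (\<Prod>j\<in>UNIV. MIN i. exp (- (inverse (x $ i) * \<alpha> i j))) *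
      (\<Prod>i\<in>UNIV. exp (- (inverse (x $ i) * (C - s i))))" (is "_ = ?F")
    if x: "\<And>i. x $ i > 0" for x
  proof -
    \<comment> \<open>Dividing the bounds in \<open>X_le\<close> by \<open>x $ i\<close> normalises
      them to 1. \<open>Y i\<close> occurs only in component \<open>i\<close>, whereas
      \<open>Z j\<close> is shared by all components and receives the largest of its
      coefficients.\<close>
    define c where "c = case_sum (\<lambda>i. inverse (x $ i) * (C - s i)) (\<lambda>j. MAX i. inverse (x $ i) * \<alpha> i j)"
    have c_Inr: "c (Inr j) * z \<le> 1 \<longleftrightarrow> (\<forall>i. \<alpha> i j * z \<le> x $ i)" for j z
    proof -
      have "c (Inr j) * z \<le> 1 \<longleftrightarrow> (\<forall>i. inverse (x $ i) * \<alpha> i j * z \<le> 1)"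
        using x assms(3) by (simp add: c_def Max_mult_le_one less_imp_le)
      also have "\<dots> \<longleftrightarrow> (\<forall>i. \<alpha> i j * z \<le> x $ i)"
        using x by (simp add: field_simps)
      finally show ?thesis .
    qed
    have c_Inl: "c (Inl i) * y \<le> 1 \<longleftrightarrow> (C - s i) * y \<le> x $ i" for i y
      using x [of i] by (simp add: c_def field_simps)
    have c_nonneg: "c k \<ge> 0" for k
    proof (cases k)
      case (Inl i)
      then show ?thesis
        using x [of i] s_le [of i] by (simp add: c_def)
    next
      case (Inr j)
      have "(MAX i. inverse (x $ i) * \<alpha> i j) \<in> range (\<lambda>i. inverse (x $ i) * \<alpha> i j)"
        by (rule Max_in) auto
      moreover have "inverse (x $ i) * \<alpha> i j \<ge> 0" for i
        using x [of i] assms(3) by simp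
      ultimately have "(MAX i. inverse (x $ i) * \<alpha> i j) \<ge> 0"
        by (metis (no_types, lifting) rangeE)
      then show ?thesis
        using Inr by (simp add: c_def)
    qed
    have "(\<forall>i. X \<omega> $ i \<le> x $ i) \<longleftrightarrow> (\<forall>k. c k * W k \<omega> \<le> 1)" if "\<omega> \<in> space M" for \<omega>
      using that by (auto simp: X_le split_sum_all W_def c_Inl c_Inr)
    then have "joint_cdf N x = prob {\<omega> \<in> space M. \<forall>k. c k * W k \<omega> \<le> 1}"
      unfolding N_def joint_cdf_distr [OF X_measurable] by (metis (lifting))
    also have "\<dots> = exp (- (\<Sum>k\<in>UNIV. c k))"
      by (rule prob_indep_unit_frechet) (fact W_indep W_frechet c_nonneg)+
    \<comment> \<open>\<open>Min_exp_uminus\<close> turns each minimum into \<open>exp\<close> of a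
      negated maximum; \<open>minus_Max_eq_Min\<close> would rewrite that negated maximum as a
      minimum again.\<close>
    also have "\<dots> = ?F"
      by (simp add: c_def sum_UNIV_Plus Min_exp_uminus sum_negf
          del: minus_Max_eq_Min flip: exp_sum exp_add)
    finally show ?thesis .
  qed

  \<comment> \<open>Marginal distribution functions\<close>
  have margin_pos: "cdf (margin N i) x = exp (- C / x)" if x: "x > 0" for i x
  proof -
    \<comment> \<open>The coefficient 0 switches off every \<open>Y k\<close> with
      \<open>k \<noteq> i\<close>, leaving only the bounds of component \<open>i\<close>.\<close>
    define c where "c = case_sum (\<lambda>k. if k = i then (C - s i) / x else 0) (\<lambda>j. \<alpha> i j / x)"
    have c_nonneg: "c k \<ge> 0" for k
      using x s_le [of i] assms(3) by (auto simp: c_def split: sum.split)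
    have "X \<omega> $ i \<le> x \<longleftrightarrow> (\<forall>k. c k * W k \<omega> \<le> 1)" if "\<omega> \<in> space M" for \<omega>
      using that x by (auto simp: X_le split_sum_all W_def c_def field_simps)
    then have "cdf (margin N i) x = prob {\<omega> \<in> space M. \<forall>k. c k * W k \<omega> \<le> 1}"
      unfolding N_def cdf_margin_distr [OF X_measurable] by (metis (lifting))
    also have "\<dots> = exp (- (\<Sum>k\<in>UNIV. c k))"
      by (rule prob_indep_unit_frechet) (fact W_indep W_frechet c_nonneg)+
    \<comment> \<open>The weight of \<open>Y i\<close> complements that of the \<open>Z j\<close> to
      the total \<open>C / x\<close>, so the margin depends neither on \<open>i\<close> nor on
      \<open>\<alpha>\<close>.\<close>
    also have "(\<Sum>k\<in>UNIV. c k) = (C - s i) / x + s i / x"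
      by (simp add: c_def sum_UNIV_Plus s_def sum_divide_distrib)
    also have "- \<dots> = - C / x"
      by (simp add: diff_divide_distrib)
    finally show ?thesis .
  qed
  have margin_nonpos: "cdf (margin N i) x = 0" if "x \<le> 0" for i x
  proof -
    \<comment> \<open>Monotonicity bounds the value at \<open>x \<le> 0\<close> by that at any
      \<open>y > 0\<close>, which tends to 0 as \<open>y\<close> decreases to 0.\<close>
    have le: "cdf (margin N i) x \<le> exp (- C / y)" if "y > 0" for y
    proof -
      have "cdf (margin N i) x \<le> cdf (margin N i) y"
        unfolding N_def cdf_margin_distr [OF X_measurable]
        using \<open>x \<le> 0\<close> that by (intro finite_measure_mono) auto
      then show ?thesis
        using margin_pos that by simp
    qed
    have "((\<lambda>y. exp (- C / y)) \<longlongrightarrow> 0) (at_right 0)"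
      using assms(4) by real_asymp
    then have "cdf (margin N i) x \<le> 0"
      using eventually_mono [OF eventually_at_right_less le]
      by (rule tendsto_lowerbound) (auto simp: trivial_limit_at_right_real)
    then show ?thesis
      by (simp add: cdf_def antisym)
  qed
  have margin: "cdf (margin N i) = (\<lambda>x. if x > 0 then exp (- C / x) else 0)" for i
    using margin_pos margin_nonpos by (auto simp: fun_eq_iff)

  \<comment> \<open>Copula\<close>
  define K where "K = power_mixture (\<lambda>i j. \<alpha> i j / C) (\<lambda>i. 1 - (1 / C) * s i)"
  have interior: "copula_interior N u = K u" if "u \<in> box 0 1" for u
  proof -
    have u: "u $ i > 0" "u $ i < 1" for i
      using that by (auto simp: mem_box_cart)
    have quantile: "gen_inverse (cdf (margin N i)) (u $ i) = - C / ln (u $ i)" for i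
      using gen_inverse_frechet [OF assms(4) u] by (simp add: margin)
    \<comment> \<open>With the quantile in place of \<open>x $ i\<close>, the exponent becomes
      \<open>a * ln (u $ i) / C\<close>, so the exponential is a power of
      \<open>u $ i\<close>.\<close>
    have rpow: "exp (- (inverse (- C / ln (u $ i)) * a)) = rpow (u $ i) (a / C)" for i a
      using u assms(4) by (simp add: rpow_eq_exp field_simps)
    have "copula_interior N u = joint_cdf N (\<chi> i. - C / ln (u $ i))"
      by (simp add: copula_interior_def quantile)
    also have "\<dots> = (\<Prod>j\<in>UNIV. MIN i. rpow (u $ i) (\<alpha> i j / C)) *
        (\<Prod>i\<in>UNIV. rpow (u $ i) ((C - s i) / C))"
    proof (subst joint)
      show "(\<chi> i. - C / ln (u $ i)) $ i > 0" for i
        using u [of i] assms(4) by (simp add: divide_pos_neg)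
    qed (simp only: vec_lambda_beta rpow)
    also have "\<dots> = K u"
      using assms(4) by (simp add: K_def power_mixture_def diff_divide_distrib)
    finally show ?thesis .
  qed
  have "continuous_on (cbox 0 1) K"
    unfolding K_def using assms(3,4) s_le by (intro continuous_on_power_mixture) auto
  then have copula: "copula N u = K u" if "u \<in> cbox 0 1" for u
    using interior that by (rule copula_eqI)

  \<comment> \<open>Max-stability\<close>
  have "max_stable (copula N)"
    unfolding max_stable_def
  proof (intro allI impI ballI)
    fix t :: real and u :: "real ^ 'n"
    assume t: "t > 0" and u: "u \<in> cbox 0 1"
    \<comment> \<open>Positive powers preserve the closed cube, so \<open>copula N\<close> agrees
      with \<open>K\<close> at both points and inherits its homogeneity.\<close>
    have "(\<chi> i. (u $ i) powr t) \<in> cbox 0 1"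
      using t u by (auto simp: mem_box_cart powr_le1)
    then show "copula N u powr t = copula N (\<chi> i. (u $ i) powr t)"
      using power_mixture_powr [OF t u] by (simp add: copula u K_def)
  qed
  moreover have "extreme_value_cdf (cdf (margin N i))" for i
    using assms(4) margin by (intro extreme_value_cdf_frechet) auto
  moreover have "prob_space N"
    unfolding N_def by (rule prob_space_distr) measurable
  ultimately have "multivariate_extreme_value N"
    by (simp add: multivariate_extreme_value_def) (simp add: N_def)
  then show ?thesis
    using joint copula unfolding N_def K_def power_mixture_def s_def by blast
qed

end
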